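(* Let $b\in\{4,5,7,8\}$, let $f=2b-3$, and let $k$ be the unique integer closest to $b/3$. Let $r_1\ge r_2\ge\dots\ge r_k\ge 0$ be fixed integers. Then the following identity holds (as an identity in the variable $q$). If $b=3k+1$ (i.e. $b=4,7$), then $$\sum_{\mathbf{n}}q^{Q_{3,b}(\mathbf{n})}\left(\prod_{j=1}^{k}\genfrac{[}{]}{0pt}{}{n_{3j+2}}{n_{3j-1}}_q\right)\prod_{j=1}^{k}\genfrac{[}{]}{0pt}{}{r_{k-j+1}-n_{3j-5}}{n_{3j-2}-n_{3j-5}}_q=\sum_{m_1,\dots,m_k}q^{\sum_{i=1}^k(r_i^2-r_im_i+m_i^2)}\genfrac{[}{]}{0pt}{}{2r_k}{m_k}_q\prod_{i=1}^{k-1}\genfrac{[}{]}{0pt}{}{r_i-r_{i+1}+m_{i+1}}{m_i}_q.$$ If $b=3k-1$ (i.e. $b=5,8$), then $$\sum_{\mathbf{n}}q^{Q_{3,b}(\mathbf{n})}\left(\prod_{j=1}^{k-1}\genfrac{[}{]}{0pt}{}{n_{3j+1}}{n_{3j-2}}_q\right)\prod_{j=1}^{k-1}\genfrac{[}{]}{0pt}{}{r_{k-j}-n_{3j-4}}{n_{3j-1}-n_{3j-4}}_q=\sum_{m_1,\dots,m_{k-1}}q^{r_k^2+\sum_{i=1}^{k-1}(r_i^2-r_im_i+m_i^2)}\genfrac{[}{]}{0pt}{}{r_{k-1}+r_k}{m_{k-1}}_q\prod_{i=1}^{k-2}\genfrac{[}{]}{0pt}{}{r_i-r_{i+1}+m_{i+1}}{m_i}_q.$$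 In both cases the sum on the left is over all $\mathbf{n}=(n_i)_{i\in G}\in\mathbb{Z}^G$ subject to $n_{f+3-3j}=r_j$ for $j=1,\dots,k$, with the convention $n_i=0$ for $i<0$, and the sum on the right is over all integers $m_i$.
   Context: Let $b>3$ be an integer coprime to $3$. $\Gamma=\langle 3,b\rangle=\{3x+by:x,y\in\mathbb{Z}_{\ge0}\}$ and $G=\mathbb{Z}_{\ge0}\setminus\Gamma$ is its finite set of gaps, whose maximum is $f=2b-3$. For an integer $x$ put $$U(x)=1_{x\ge0}-1_{x\ge3}-1_{x\ge b}+1_{x\ge b+3},$$ where $1_{x\ge c}$ equals $1$ if $x\ge c$ and $0$ otherwise. For $\mathbf{n}=(n_i)_{i\in G}\in\mathbb{Z}^G$, $$Q_{3,b}(\mathbf{n})=\sum_{i,j\in G}U(j-i)\,n_in_j$$ (sum over all ordered pairs). With $(q)_m=\prod_{j=1}^m(1-q^j)$, the $q$-binomial coefficient is $\genfrac{[}{]}{0pt}{}{N}{M}_q=\frac{(q)_N}{(q)_M(q)_{N-M}}$ if $0\le M\le N$, and $0$ otherwise (in particular $0$ if $N<0$). With this convention all sums have only finitely many nonzero terms. Empty products equal $1$ and empty sums equal $0$. *)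

theory Defs
  imports Complex_Main "HOL-Computational_Algebra.Computational_Algebra"
begin

definition semigroup3 :: "int \<Rightarrow> int set" where
  "semigroup3 b = {3 * x + b * y | x y. 0 \<le> x \<and> 0 \<le> y}"

definition gaps3 :: "int \<Rightarrow> int set" where
  "gaps3 b = {i. 0 \<le> i} - semigroup3 b"

definition U :: "int \<Rightarrow> int \<Rightarrow> int" where
  "U b x = of_bool (x \<ge> 0) - of_bool (x \<ge> 3) - of_bool (x \<ge> b) + of_bool (x \<ge> b + 3)"

definition Q3 :: "int \<Rightarrow> (int \<Rightarrow> int) \<Rightarrow> int" where
  "Q3 b n = (\<Sum>i\<in>gaps3 b. \<Sum>j\<in>gaps3 b. U b (j - i) * n i * n j)"

(* A family (v i) indexed by I is represented by its extension by 0 to all integers.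
   For I = gaps3 b this includes the convention v i = 0 for i < 0. *)
definition int_vectors :: "int set \<Rightarrow> (int \<Rightarrow> int) set" where
  "int_vectors I = {v. \<forall>i. i \<notin> I \<longrightarrow> v i = 0}"

(* The indeterminate q, as an element of the field of rational functions. *)
definition qvar :: "rat poly fract" where
  "qvar = to_fract [:0, 1:]"

definition qfact :: "nat \<Rightarrow> rat poly fract" where
  "qfact m = (\<Prod>j=1..m. 1 - qvar ^ j)"

definition qbinom :: "int \<Rightarrow> int \<Rightarrow> rat poly fract" where
  "qbinom N M = (if 0 \<le> M \<and> M \<le> N
     then qfact (nat N) / (qfact (nat M) * qfact (nat (N - M))) else 0)"

(* Sums over infinite index sets are written with sum' from Groups_Big, the sum over those
   indices whose term is nonzero (with value 0 if there are infinitely many of them).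
   In the sums considered here the q-binomial coefficients bound every free coordinate
   of an index with nonzero term, so only finitely many terms are nonzero. *)

end

theory Submission
  imports Defs
begin

text \<open>
  Two kinds of sums over q-binomial coefficients occur: convolutions, which are evaluated by the
  q-Vandermonde identity, and H(N, t) = \<Sum>m. q^(m^2 + t m) [N, m] (\<open>rr_sum\<close>), a finite form of the
  Rogers-Ramanujan sums, which has no closed form but obeys two recurrences.

  On the right, the sum over m_1 is an H. For b = 4 and b = 5 that is all; for b = 7 and b = 8 what
  remains is a sum over p = m_2 of q^(p^2 - r p) H(R - r + p, -R) [r + s, p]
  (\<open>nested_rr_sum\<close>, where R = r_1, r = r_2, and s is r_2 for b = 7 and r_3 for b = 8).

  On the left, with suitable increments of the n_i as new variables, two of the free variables
  enter only through a convolution, so that q-Vandermonde (\<open>q_Vandermonde_rr_sum\<close>) turns them into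
  one H. For b = 4 and b = 5 no variable is left and the identity is proved. For b = 7 and b = 8 there
  remain sums of H(N - a, t + 2a), in which the length and the exponent of H move together, whereas
  on the right only the length moves. The bridge is \<open>rr_sum_transform\<close>, for T, M \<ge> 0,

    \<Sum>a. q^(2 a^2 + (M + 2t) a) [T, a] H(M + T - a, t + 2a)
      = \<Sum>m. q^(m (m + M + t)) [T, m] H(M + m, t).

  It is proved by induction on T: by the two Pascal rules for q-binomial coefficients, which give two
  recurrences for H, both sides F(T, M) satisfy
  F(T + 1, M) = F(T, M) + q^(t + M + T + 1) F(T, M + 1) and equal H(M, t) at T = 0.
  For b = 7 one applies it for each value of n_5 and then recombines with q-Vandermonde; for b = 8
  q-Vandermonde first combines n_1 and n_2 into n_1 + n_2, and one application finishes.
\<close>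

section \<open>Gaussian binomial coefficients\<close>

lemma qvar_power: "qvar ^ j = to_fract (monom 1 j)"
proof (induction j)
  case (Suc j)
  then show ?case
    by (simp add: qvar_def monom_Suc flip: to_fract_mult)
qed (simp add: monom_0 flip: one_pCons)

lemma qvar_nonzero [simp]: "qvar \<noteq> 0"
  by (simp add: qvar_def)

lemma qfact_0 [simp]: "qfact 0 = 1"
  by (simp add: qfact_def)

lemma qfact_Suc: "qfact (Suc n) = qfact n * (1 - qvar ^ Suc n)"
  by (simp add: qfact_def)

lemma one_minus_qvar_power_nonzero: "1 - qvar ^ Suc j \<noteq> 0"
proof
  assume "1 - qvar ^ Suc j = 0"
  then have "to_fract (monom (1::rat) (Suc j)) = to_fract 1"
    by (metis eq_iff_diff_eq_0 qvar_power to_fract_1)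
  then have "monom (1::rat) (Suc j) = 1"
    by (simp only: to_fract_eq_iff)
  then have "degree (monom (1::rat) (Suc j)) = 0"
    by simp
  then show False
    by (simp add: degree_monom_eq)
qed

lemma qfact_nonzero [simp]: "qfact n \<noteq> 0"
  by (induction n) (use one_minus_qvar_power_nonzero in \<open>auto simp: qfact_Suc simp del: power_Suc\<close>)

lemma qbinom_eq_0: "M < 0 \<or> N < M \<Longrightarrow> qbinom N M = 0"
  by (auto simp: qbinom_def)

lemma qbinom_nonzero_iff: "qbinom N M \<noteq> 0 \<longleftrightarrow> 0 \<le> M \<and> M \<le> N"
  by (auto simp: qbinom_def)

lemma qbinom_0 [simp]: "0 \<le> N \<Longrightarrow> qbinom N 0 = 1"
  by (simp add: qbinom_def)

lemma qbinom_self [simp]: "0 \<le> N \<Longrightarrow> qbinom N N = 1"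
  by (simp add: qbinom_def)

lemma qbinom_symmetric: "qbinom N (N - M) = qbinom N M"
  by (auto simp: qbinom_def)

text \<open>
  Both sides are the trinomial coefficient counting flags of dimensions M and M + L. The identity
  holds for all integers since each side vanishes unless M, L and N - M - L are nonnegative.
\<close>

lemma qbinom_revision: "qbinom N (M + L) * qbinom (M + L) M = qbinom N M * qbinom (N - M) L"
  by (auto simp: qbinom_def diff_diff_eq)

text \<open>
  The Pascal rule for all integers M, which is what lets later sums run over intervals that are
  longer than the support of the binomial. In the main range, division by the common factors leaves
  1 - q^(a+c+2) = (1 - q^(c+1)) + q^(c+1) (1 - q^(a+1)).
\<close>

lemma qbinom_Suc:
  assumes "0 \<le> N"
  shows "qbinom (N + 1) M = qbinom N M + qvar powi (N + 1 - M) * qbinom N (M - 1)"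
proof (cases "1 \<le> M \<and> M \<le> N")
  case True
  define a c where "a = nat (M - 1)" and "c = nat (N - M)"
  have n: "nat N = Suc (a + c)" "nat (N + 1) = Suc (Suc (a + c))" "nat M = Suc a"
    "nat (N - M) = c" "nat (N + 1 - M) = Suc c" "nat (M - 1) = a" "nat (N - (M - 1)) = Suc c"
    using True by (auto simp: a_def c_def)
  have e: "1 - qvar ^ Suc (Suc (a + c)) = (1 - qvar ^ Suc c) + qvar ^ Suc c * (1 - qvar ^ Suc a)"
    by (simp add: algebra_simps power_add)
  have l: "qbinom (N + 1) M = qfact (Suc (Suc (a + c))) / (qfact (Suc a) * qfact (Suc c))"
    "qbinom N M = qfact (Suc (a + c)) / (qfact (Suc a) * qfact c)"
    "qbinom N (M - 1) = qfact (Suc (a + c)) / (qfact a * qfact (Suc c))"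
    using True unfolding qbinom_def n by auto
  have p: "qvar powi (N + 1 - M) = qvar ^ Suc c"
    using True n(5) by (simp add: power_int_def)
  show ?thesis
    unfolding l p qfact_Suc[of "Suc (a + c)"] e
    unfolding qfact_Suc[of a] qfact_Suc[of c]
    using one_minus_qvar_power_nonzero[of a] one_minus_qvar_power_nonzero[of c]
    by (simp add: divide_simps del: power_Suc) (simp add: algebra_simps)
next
  case False
  then consider "M < 0" | "M = 0" | "M = N + 1" | "M > N + 1"
    by linarith
  then show ?thesis
    using assms by cases (auto simp: qbinom_eq_0)
qed

lemma qbinom_Suc':
  assumes "0 \<le> N"
  shows "qbinom (N + 1) M = qvar powi M * qbinom N M + qbinom N (M - 1)"
  using qbinom_Suc[OF assms, of "N + 1 - M"] qbinom_symmetric[of "N + 1" M]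
    qbinom_symmetric[of N M] qbinom_symmetric[of N "M - 1"]
  by (simp add: algebra_simps)

lemma sum_qbinom_extend:
  assumes "N \<le> K"
  shows "(\<Sum>m\<in>{0..K}. f m * qbinom N m) = (\<Sum>m\<in>{0..N}. f m * qbinom N m)"
  by (rule sum.mono_neutral_right) (use assms in \<open>auto simp: qbinom_eq_0\<close>)

lemma sum_qbinom_shift:
  assumes "0 \<le> N"
  shows "(\<Sum>m\<in>{0..N + 1}. f m * qbinom N (m - 1)) = (\<Sum>m\<in>{0..N}. f (m + 1) * qbinom N m)"
proof -
  have "(\<Sum>m\<in>{0..N + 1}. f m * qbinom N (m - 1)) = (\<Sum>m\<in>{1..N + 1}. f m * qbinom N (m - 1))"
    by (rule sum.mono_neutral_right) (auto simp: qbinom_eq_0)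
  also have "\<dots> = (\<Sum>m\<in>{0..N}. f (m + 1) * qbinom N m)"
    by (rule sum.reindex_bij_witness[of _ "\<lambda>m. m + 1" "\<lambda>m. m - 1"]) auto
  finally show ?thesis .
qed

text \<open>
  The Pascal rules in summed form: the index shift is moved onto the summand, so that in each
  induction below both sides become sums against the same binomial coefficient, which can be
  compared term by term.
\<close>

lemma sum_qbinom_Suc:
  assumes "0 \<le> N"
  shows "(\<Sum>m\<in>{0..N + 1}. f m * qbinom (N + 1) m)
    = (\<Sum>m\<in>{0..N}. (f m + qvar powi (N - m) * f (m + 1)) * qbinom N m)"
proof -
  have "(\<Sum>m\<in>{0..N + 1}. f m * qbinom (N + 1) m)
    = (\<Sum>m\<in>{0..N + 1}. f m * qbinom N m)
      + (\<Sum>m\<in>{0..N + 1}. (qvar powi (N + 1 - m) * f m) * qbinom N (m - 1))"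
    unfolding sum.distrib[symmetric]
    by (intro sum.cong refl) (simp add: qbinom_Suc[OF assms] distrib_left mult_ac)
  also have "\<dots> = (\<Sum>m\<in>{0..N}. (f m + qvar powi (N - m) * f (m + 1)) * qbinom N m)"
    unfolding sum_qbinom_shift[OF assms, of "\<lambda>m. qvar powi (N + 1 - m) * f m"]
    by (simp add: sum_qbinom_extend[of N "N + 1"] sum.distrib[symmetric] distrib_right)
  finally show ?thesis .
qed

lemma sum_qbinom_Suc':
  assumes "0 \<le> N"
  shows "(\<Sum>m\<in>{0..N + 1}. f m * qbinom (N + 1) m)
    = (\<Sum>m\<in>{0..N}. (qvar powi m * f m + f (m + 1)) * qbinom N m)"
proof -
  have "(\<Sum>m\<in>{0..N + 1}. f m * qbinom (N + 1) m)
    = (\<Sum>m\<in>{0..N + 1}. (qvar powi m * f m) * qbinom N m)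
      + (\<Sum>m\<in>{0..N + 1}. f m * qbinom N (m - 1))"
    unfolding sum.distrib[symmetric]
    by (intro sum.cong refl) (simp add: qbinom_Suc'[OF assms] distrib_left mult_ac)
  also have "\<dots> = (\<Sum>m\<in>{0..N}. (qvar powi m * f m + f (m + 1)) * qbinom N m)"
    unfolding sum_qbinom_shift[OF assms]
    by (simp add: sum_qbinom_extend[of N "N + 1"] sum.distrib[symmetric] distrib_right)
  finally show ?thesis .
qed

lemma qvar_powi_mult: "qvar powi x * qvar powi y = qvar powi (x + y)"
  by (simp add: power_int_add)

lemma qvar_powi_mult_left: "qvar powi x * (qvar powi y * c) = qvar powi (x + y) * c"
  by (simp add: power_int_add)

section \<open>The q-Vandermonde convolution\<close>

text \<open>
  The usual identity compares the coefficients of g m; an arbitrary weight g is carried along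
  because this makes the induction on A immediate: the Pascal rule replaces g by
  g m + q^(A + B - m) g (m + 1) on both sides. The sums over m are also how the identity is used.
\<close>

lemma q_Vandermonde:
  assumes "0 \<le> A" "0 \<le> B"
  shows "(\<Sum>x\<in>{0..A}. \<Sum>y\<in>{0..B}. g (x + y) * qvar powi (x * (B - y)) * qbinom A x * qbinom B y)
    = (\<Sum>m\<in>{0..A + B}. g m * qbinom (A + B) m)"
  using assms(1)
proof (induction A arbitrary: g rule: int_ge_induct)
  case base
  then show ?case
    by simp
next
  case (step A)
  define g' where "g' m = g m + qvar powi (A + B - m) * g (m + 1)" for m
  have "(\<Sum>x\<in>{0..A + 1}. \<Sum>y\<in>{0..B}.
        g (x + y) * qvar powi (x * (B - y)) * qbinom (A + 1) x * qbinom B y)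
      = (\<Sum>y\<in>{0..B}. (\<Sum>x\<in>{0..A + 1}. (g (x + y) * qvar powi (x * (B - y))) * qbinom (A + 1) x)
          * qbinom B y)"
    by (subst sum.swap) (simp add: sum_distrib_right)
  also have "\<dots> = (\<Sum>y\<in>{0..B}. (\<Sum>x\<in>{0..A}. (g' (x + y) * qvar powi (x * (B - y))) * qbinom A x)
          * qbinom B y)"
  proof -
    have "(\<Sum>x\<in>{0..A + 1}. (g (x + y) * qvar powi (x * (B - y))) * qbinom (A + 1) x)
       = (\<Sum>x\<in>{0..A}. (g' (x + y) * qvar powi (x * (B - y))) * qbinom A x)" for y
      unfolding sum_qbinom_Suc[OF step.hyps]
      by (intro sum.cong refl)
        (simp add: g'_def algebra_simps qvar_powi_mult qvar_powi_mult_left)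
    then show ?thesis
      by (simp only:)
  qed
  also have "\<dots> = (\<Sum>x\<in>{0..A}. \<Sum>y\<in>{0..B}.
      g' (x + y) * qvar powi (x * (B - y)) * qbinom A x * qbinom B y)"
    by (subst sum.swap) (simp add: sum_distrib_right)
  also have "\<dots> = (\<Sum>m\<in>{0..A + B}. g' m * qbinom (A + B) m)"
    by (rule step.IH)
  also have "\<dots> = (\<Sum>m\<in>{0..A + 1 + B}. g m * qbinom (A + 1 + B) m)"
    using sum_qbinom_Suc[of "A + B" g] step.hyps assms(2)
    by (simp add: g'_def add_ac)
  finally show ?case .
qed

lemma q_Vandermonde_box:
  assumes "0 \<le> A" "0 \<le> B" "A \<le> X" "B \<le> Y"
  shows "(\<Sum>x\<in>{0..X}. \<Sum>y\<in>{0..Y}. g (x + y) * qvar powi (x * (B - y)) * qbinom A x * qbinom B y)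
    = (\<Sum>m\<in>{0..A + B}. g m * qbinom (A + B) m)"
proof -
  have "(\<Sum>x\<in>{0..X}. \<Sum>y\<in>{0..Y}. g (x + y) * qvar powi (x * (B - y)) * qbinom A x * qbinom B y)
    = (\<Sum>x\<in>{0..X}. \<Sum>y\<in>{0..B}. g (x + y) * qvar powi (x * (B - y)) * qbinom A x * qbinom B y)"
    by (intro sum.cong refl sum_qbinom_extend assms)
  also have "\<dots> = (\<Sum>x\<in>{0..A}. \<Sum>y\<in>{0..B}.
      g (x + y) * qvar powi (x * (B - y)) * qbinom A x * qbinom B y)"
    by (rule sum.mono_neutral_right) (use assms in \<open>auto simp: qbinom_eq_0\<close>)
  finally show ?thesis
    using q_Vandermonde[OF assms(1,2)] by simp
qed

section \<open>Finite Rogers-Ramanujan sums\<close>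

text \<open>
  At N = \<infinity> with t = 0 or t = 1 these are the sums of the two Rogers-Ramanujan identities. The exponent t
  stands for the variable z = q^t of the polynomial \<Sum>m. q^(m^2) z^m [N, m].
\<close>

definition rr_sum :: "int \<Rightarrow> int \<Rightarrow> rat poly fract" where
  "rr_sum N t = (\<Sum>m\<in>{0..N}. qvar powi (m\<^sup>2 + t * m) * qbinom N m)"

lemma q_Vandermonde_rr_sum:
  assumes "0 \<le> A" "0 \<le> B" "A \<le> X" "B \<le> Y"
  shows "(\<Sum>x\<in>{0..X}. \<Sum>y\<in>{0..Y}.
      qvar powi ((x + y)\<^sup>2 + t * (x + y) + x * (B - y)) * qbinom A x * qbinom B y) = rr_sum (A + B) t"
  using q_Vandermonde_box[OF assms, of "\<lambda>m. qvar powi (m\<^sup>2 + t * m)"]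
  by (simp add: rr_sum_def qvar_powi_mult)

lemma rr_sum_Suc:
  assumes "0 \<le> N"
  shows "rr_sum (N + 1) t = rr_sum N t + qvar powi (t + N + 1) * rr_sum N (t + 1)"
  unfolding rr_sum_def sum_qbinom_Suc[OF assms] sum_distrib_left sum.distrib[symmetric]
  by (intro sum.cong refl)
    (simp add: algebra_simps power2_eq_square qvar_powi_mult qvar_powi_mult_left)

lemma rr_sum_Suc':
  assumes "0 \<le> N"
  shows "rr_sum (N + 1) t = rr_sum N (t + 1) + qvar powi (t + 1) * rr_sum N (t + 2)"
  unfolding rr_sum_def sum_qbinom_Suc'[OF assms] sum_distrib_left sum.distrib[symmetric]
  by (intro sum.cong refl)
    (simp add: algebra_simps power2_eq_square qvar_powi_mult qvar_powi_mult_left)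

text \<open>
  Both sides satisfy the same recurrence in T, which raises M in one of its two terms; hence the
  induction is for all M at once. On the left, the Pascal rule for [T + 1, a] produces
  H(M + T + 1 - a, t + 2a) and H(M + T - a, t + 2a + 2). The first is split by \<open>rr_sum_Suc\<close> into the
  summand for T and a multiple of H(M + T - a, t + 2a + 1); the latter and the second term recombine
  by \<open>rr_sum_Suc'\<close> into H(M + 1 + T - a, t + 2a). On the right the Pascal rule suffices.
\<close>

lemma rr_sum_transform:
  assumes "0 \<le> T" "0 \<le> M"
  shows "(\<Sum>a\<in>{0..T}. qvar powi (2 * a\<^sup>2 + (M + 2 * t) * a) * rr_sum (M + T - a) (t + 2 * a) * qbinom T a)
    = (\<Sum>m\<in>{0..T}. qvar powi (m * (m + M + t)) * rr_sum (M + m) t * qbinom T m)"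
    (is "?L T M = ?R T M")
  using assms
proof (induction T arbitrary: M rule: int_ge_induct)
  case base
  then show ?case
    by simp
next
  case (step T)
  have "?L (T + 1) M = ?L T M + qvar powi (t + M + T + 1) * ?L T (M + 1)"
    unfolding sum_qbinom_Suc[OF step.hyps] sum_distrib_left sum.distrib[symmetric]
  proof (intro sum.cong refl)
    fix a assume a: "a \<in> {0..T}"
    have 1: "rr_sum (M + (T + 1) - a) (t + 2 * a) = rr_sum (M + T - a) (t + 2 * a)
      + qvar powi (t + a + (M + T + 1)) * rr_sum (M + T - a) (t + 2 * a + 1)"
      using rr_sum_Suc[of "M + T - a" "t + 2 * a"] a step.prems by (simp add: algebra_simps)
    have 2: "rr_sum (M + 1 + T - a) (t + 2 * a) = rr_sum (M + T - a) (t + 2 * a + 1)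
      + qvar powi (t + 2 * a + 1) * rr_sum (M + T - a) (t + 2 * a + 2)"
      using rr_sum_Suc'[of "M + T - a" "t + 2 * a"] a step.prems by (simp add: algebra_simps)
    have 3: "M + (T + 1) - (a + 1) = M + T - a" "t + 2 * (a + 1) = t + 2 * a + 2"
      by auto
    show "(qvar powi (2 * a\<^sup>2 + (M + 2 * t) * a) * rr_sum (M + (T + 1) - a) (t + 2 * a) +
          qvar powi (T - a) * (qvar powi (2 * (a + 1)\<^sup>2 + (M + 2 * t) * (a + 1))
            * rr_sum (M + (T + 1) - (a + 1)) (t + 2 * (a + 1)))) * qbinom T a =
         qvar powi (2 * a\<^sup>2 + (M + 2 * t) * a) * rr_sum (M + T - a) (t + 2 * a) * qbinom T a +
         qvar powi (t + M + T + 1) * (qvar powi (2 * a\<^sup>2 + (M + 1 + 2 * t) * a)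
            * rr_sum (M + 1 + T - a) (t + 2 * a) * qbinom T a)"
      unfolding 1 2 3
      by (simp add: distrib_left distrib_right qvar_powi_mult qvar_powi_mult_left mult.assoc)
         (simp add: algebra_simps power2_eq_square)
  qed
  also have "\<dots> = ?R T M + qvar powi (t + M + T + 1) * ?R T (M + 1)"
    using step.IH[of M] step.IH[of "M + 1"] step.prems by simp
  also have "\<dots> = ?R (T + 1) M"
    unfolding sum_qbinom_Suc[OF step.hyps] sum_distrib_left sum.distrib[symmetric]
  proof (intro sum.cong refl)
    fix m
    have 3: "M + 1 + m = M + (m + 1)" by simp
    show "qvar powi (m * (m + M + t)) * rr_sum (M + m) t * qbinom T m +
         qvar powi (t + M + T + 1) * (qvar powi (m * (m + (M + 1) + t)) * rr_sum (M + 1 + m) t * qbinom T m) =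
         (qvar powi (m * (m + M + t)) * rr_sum (M + m) t +
          qvar powi (T - m) * (qvar powi ((m + 1) * (m + 1 + M + t)) * rr_sum (M + (m + 1)) t)) * qbinom T m"
      unfolding 3
      by (simp add: distrib_left distrib_right qvar_powi_mult qvar_powi_mult_left mult.assoc)
         (simp add: algebra_simps power2_eq_square)
  qed
  finally show ?case .
qed

section \<open>Gaps and the quadratic form\<close>

text \<open>
  Since 3 b lies in the semigroup generated by 3, the coefficient of b can be reduced modulo 3.
\<close>

lemma semigroup3_iff:
  assumes "0 \<le> b"
  shows "i \<in> semigroup3 b \<longleftrightarrow> (\<exists>y\<in>{0, 1, 2}. b * y \<le> i \<and> 3 dvd i - b * y)"
proof
  assume "i \<in> semigroup3 b"
  then obtain x y where xy: "i = 3 * x + b * y" "0 \<le> x" "0 \<le> y"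
    by (auto simp: semigroup3_def)
  have "b * y = b * (y mod 3) + 3 * (b * (y div 3))"
    by (metis distrib_left mult.left_commute mod_mult_div_eq)
  then have "i - b * (y mod 3) = 3 * (x + b * (y div 3))"
    using xy by (simp add: algebra_simps)
  moreover have "0 \<le> x + b * (y div 3)"
    using xy assms by (simp add: pos_imp_zdiv_nonneg_iff)
  moreover have "y mod 3 \<in> {0, 1, 2}"
    by auto
  ultimately show "\<exists>y\<in>{0, 1, 2}. b * y \<le> i \<and> 3 dvd i - b * y"
    by (intro bexI[of _ "y mod 3"]) auto
next
  assume "\<exists>y\<in>{0, 1, 2}. b * y \<le> i \<and> 3 dvd i - b * y"
  then obtain y x where "y \<in> {0, 1, 2}" "b * y \<le> i" "i - b * y = 3 * x"
    by (auto simp only: dvd_def)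
  then have "i = 3 * x + b * y" "0 \<le> x" "0 \<le> y"
    by auto
  then show "i \<in> semigroup3 b"
    unfolding semigroup3_def by blast
qed

text \<open>
  Everything above the Frobenius number 2 b - 3 lies in the semigroup, because 0, b, 2 b represent all
  residues modulo 3; up to it, membership is a finite check.
\<close>

lemma gaps3_eq_filter:
  assumes "4 \<le> b" "\<not> 3 dvd b"
  shows "gaps3 b = Set.filter (\<lambda>i. \<forall>y\<in>{0, 1, 2}. b * y \<le> i \<longrightarrow> \<not> 3 dvd i - b * y) {0..2 * b - 3}"
proof -
  have "i \<in> semigroup3 b" if "2 * b - 3 < i" for i
  proof -
    have "3 dvd i \<or> 3 dvd i - b \<or> 3 dvd i - b * 2"
      using assms(2) by presburger
    then show ?thesis
    proof (elim disjE)
      assume 3: "3 dvd i - b * 2"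
      then have "2 * b \<le> i"
        using that by presburger
      with 3 show ?thesis
        using assms(1) by (auto simp: semigroup3_iff)
    qed (use assms(1) that in \<open>auto simp: semigroup3_iff\<close>)
  qed
  then have "i \<in> gaps3 b \<longleftrightarrow> i \<in> {0..2 * b - 3} \<and> i \<notin> semigroup3 b" for i
    by (auto simp: gaps3_def not_less[symmetric])
  then show ?thesis
    using assms(1) by (auto simp: semigroup3_iff)
qed

lemma gaps3_values:
  "gaps3 4 = {1, 2, 5}"
  "gaps3 5 = {1, 2, 4, 7}"
  "gaps3 7 = {1, 2, 4, 5, 8, 11}"
  "gaps3 8 = {1, 2, 4, 5, 7, 10, 13}"
  by (simp_all add: gaps3_eq_filter simp_from_to)
     (auto simp: simp_from_to)

text \<open>
  U is 1 on {0, 1, 2}, -1 on {b, b + 1, b + 2} and 0 elsewhere, so the matrix of the form is sparse and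
  is evaluated row by row.
\<close>

lemma Q3_4: "Q3 4 n = (n 1)\<^sup>2 + (n 2)\<^sup>2 + (n 5)\<^sup>2 + n 1 * n 2 - n 1 * n 5"
proof -
  define row where "row i = (\<Sum>j\<in>gaps3 4. U 4 (j - i) * n j)" for i
  have rows: "row 1 = n 1 + n 2 - n 5"
    "row 2 = n 2"
    "row 5 = n 5"
    by (simp_all add: row_def gaps3_values U_def)
  have "Q3 4 n = (\<Sum>i\<in>gaps3 4. n i * row i)"
    by (simp add: Q3_def row_def sum_distrib_left mult_ac)
  then show ?thesis
    by (simp add: gaps3_values rows) (simp add: algebra_simps power2_eq_square)
qed

lemma Q3_5: "Q3 5 n = (n 1)\<^sup>2 + (n 2)\<^sup>2 + (n 4)\<^sup>2 + (n 7)\<^sup>2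
    + n 1 * n 2 + n 2 * n 4 - n 1 * n 7 - n 2 * n 7"
proof -
  define row where "row i = (\<Sum>j\<in>gaps3 5. U 5 (j - i) * n j)" for i
  have rows: "row 1 = n 1 + n 2 - n 7"
    "row 2 = n 2 + n 4 - n 7"
    "row 4 = n 4"
    "row 7 = n 7"
    by (simp_all add: row_def gaps3_values U_def)
  have "Q3 5 n = (\<Sum>i\<in>gaps3 5. n i * row i)"
    by (simp add: Q3_def row_def sum_distrib_left mult_ac)
  then show ?thesis
    by (simp add: gaps3_values rows) (simp add: algebra_simps power2_eq_square)
qed

lemma Q3_7: "Q3 7 n = (n 1)\<^sup>2 + (n 2)\<^sup>2 + (n 4)\<^sup>2 + (n 5)\<^sup>2 + (n 8)\<^sup>2 + (n 11)\<^sup>2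
    + n 1 * n 2 + n 2 * n 4 + n 4 * n 5 - n 1 * n 8 - n 2 * n 11 - n 4 * n 11"
proof -
  define row where "row i = (\<Sum>j\<in>gaps3 7. U 7 (j - i) * n j)" for i
  have rows: "row 1 = n 1 + n 2 - n 8"
    "row 2 = n 2 + n 4 - n 11"
    "row 4 = n 4 + n 5 - n 11"
    "row 5 = n 5"
    "row 8 = n 8"
    "row 11 = n 11"
    by (simp_all add: row_def gaps3_values U_def)
  have "Q3 7 n = (\<Sum>i\<in>gaps3 7. n i * row i)"
    by (simp add: Q3_def row_def sum_distrib_left mult_ac)
  then show ?thesis
    by (simp add: gaps3_values rows) (simp add: algebra_simps power2_eq_square)
qed

lemma Q3_8: "Q3 8 n = (n 1)\<^sup>2 + (n 2)\<^sup>2 + (n 4)\<^sup>2 + (n 5)\<^sup>2 + (n 7)\<^sup>2 + (n 10)\<^sup>2 + (n 13)\<^sup>2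
    + n 1 * n 2 + n 2 * n 4 + n 4 * n 5 + n 5 * n 7
    - n 1 * n 10 - n 2 * n 10 - n 4 * n 13 - n 5 * n 13"
proof -
  define row where "row i = (\<Sum>j\<in>gaps3 8. U 8 (j - i) * n j)" for i
  have rows: "row 1 = n 1 + n 2 - n 10"
    "row 2 = n 2 + n 4 - n 10"
    "row 4 = n 4 + n 5 - n 13"
    "row 5 = n 5 + n 7 - n 13"
    "row 7 = n 7"
    "row 10 = n 10"
    "row 13 = n 13"
    by (simp_all add: row_def gaps3_values U_def)
  have "Q3 8 n = (\<Sum>i\<in>gaps3 8. n i * row i)"
    by (simp add: Q3_def row_def sum_distrib_left mult_ac)
  then show ?thesis
    by (simp add: gaps3_values rows) (simp add: algebra_simps power2_eq_square)
qed

section \<open>The two fourfold sums\<close>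

text \<open>
  The common value of the two sides for b = 7 and b = 8, up to a constant power of q: the double sum
  over m_2 = p and m_1, with the sum over m_1 written as a finite Rogers-Ramanujan sum.
\<close>

definition nested_rr_sum :: "int \<Rightarrow> int \<Rightarrow> int \<Rightarrow> rat poly fract" where
  "nested_rr_sum R r s = (\<Sum>p\<in>{0..r + s}. qvar powi (p\<^sup>2 - r * p) * rr_sum (R - r + p) (- R) * qbinom (r + s) p)"

text \<open>
  The left side for b = 7 in the variables a = n_1, d = n_2, i = n_4 - n_1, e = n_5. The sum over i and d is a
  convolution of [R - a, i] and [e, d]; then \<open>rr_sum_transform\<close> is applied to the sum over a for each e,
  and the result is a convolution of [s, e] and [r, m].
\<close>

lemma quadruple_sum_7:
  assumes "0 \<le> s" "0 \<le> r" "r \<le> R"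
  shows "(\<Sum>e\<in>{0..s}. \<Sum>a\<in>{0..r}. \<Sum>i\<in>{0..R}. \<Sum>d\<in>{0..s}.
      qvar powi (a\<^sup>2 + d\<^sup>2 + (a + i)\<^sup>2 + e\<^sup>2 + a * d + d * (a + i) + (a + i) * e
         - a * r - d * R - (a + i) * R)
      * (qbinom e d * qbinom s e * qbinom r a * qbinom (R - a) i)) = nested_rr_sum R r s"
    (is "?L = _")
proof -
  have inner: "(\<Sum>i\<in>{0..R}. \<Sum>d\<in>{0..s}.
      qvar powi (a\<^sup>2 + d\<^sup>2 + (a + i)\<^sup>2 + e\<^sup>2 + a * d + d * (a + i) + (a + i) * e
         - a * r - d * R - (a + i) * R)
      * (qbinom e d * qbinom s e * qbinom r a * qbinom (R - a) i))
    = qvar powi (e\<^sup>2) * qbinom s e * (qvar powi (2 * a\<^sup>2 + ((R + e - r) + 2 * (- R)) * a)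
        * rr_sum ((R + e - r) + r - a) (- R + 2 * a) * qbinom r a)"
    if "e \<in> {0..s}" "a \<in> {0..r}" for e a
  proof -
    \<comment> \<open>The length is written as M + T - a with M = R + e - r and T = r, to fit \<open>rr_sum_transform\<close>.\<close>
    have h: "rr_sum ((R + e - r) + r - a) (- R + 2 * a) = (\<Sum>i\<in>{0..R}. \<Sum>d\<in>{0..s}.
      qvar powi ((i + d)\<^sup>2 + (- R + 2 * a) * (i + d) + i * (e - d)) * qbinom (R - a) i * qbinom e d)"
      using q_Vandermonde_rr_sum[of "R - a" e R s "- R + 2 * a"] assms that
      by (simp add: algebra_simps)
    have "qvar powi (a\<^sup>2 + d\<^sup>2 + (a + i)\<^sup>2 + e\<^sup>2 + a * d + d * (a + i) + (a + i) * e
         - a * r - d * R - (a + i) * R)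
      = qvar powi (e\<^sup>2) * qvar powi (2 * a\<^sup>2 + ((R + e - r) + 2 * (- R)) * a)
        * qvar powi ((i + d)\<^sup>2 + (- R + 2 * a) * (i + d) + i * (e - d))" for i d
      unfolding qvar_powi_mult by (simp add: algebra_simps power2_eq_square)
    then show ?thesis
      unfolding h sum_distrib_left sum_distrib_right by (intro sum.cong refl) (simp only: mult_ac)
  qed
  have "?L = (\<Sum>e\<in>{0..s}. qvar powi (e\<^sup>2) * qbinom s e *
     (\<Sum>a\<in>{0..r}. qvar powi (2 * a\<^sup>2 + ((R + e - r) + 2 * (- R)) * a)
        * rr_sum ((R + e - r) + r - a) (- R + 2 * a) * qbinom r a))"
    unfolding sum_distrib_left by (intro sum.cong refl inner)
  also have "\<dots> = (\<Sum>e\<in>{0..s}. qvar powi (e\<^sup>2) * qbinom s e *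
     (\<Sum>m\<in>{0..r}. qvar powi (m * (m + (R + e - r) - R)) * rr_sum ((R + e - r) + m) (- R) * qbinom r m))"
  proof (intro sum.cong refl)
    fix e assume "e \<in> {0..s}"
    then show "qvar powi (e\<^sup>2) * qbinom s e *
     (\<Sum>a\<in>{0..r}. qvar powi (2 * a\<^sup>2 + ((R + e - r) + 2 * (- R)) * a)
        * rr_sum ((R + e - r) + r - a) (- R + 2 * a) * qbinom r a) = qvar powi (e\<^sup>2) * qbinom s e *
     (\<Sum>m\<in>{0..r}. qvar powi (m * (m + (R + e - r) - R)) * rr_sum ((R + e - r) + m) (- R) * qbinom r m)"
      using rr_sum_transform[of r "R + e - r" "- R"] assms by simp
  qed
  also have "\<dots> = (\<Sum>e\<in>{0..s}. \<Sum>m\<in>{0..r}. (qvar powi ((e + m)\<^sup>2 - r * (e + m)) * rr_sum (R - r + (e + m)) (- R))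
      * qvar powi (e * (r - m)) * qbinom s e * qbinom r m)"
  proof -
    have 1: "qvar powi (e\<^sup>2) * qvar powi (m * (m + (R + e - r) - R))
      = qvar powi ((e + m)\<^sup>2 - r * (e + m)) * qvar powi (e * (r - m))" for e m
      unfolding qvar_powi_mult by (simp add: algebra_simps power2_eq_square)
    have 2: "(R + e - r) + m = R - r + (e + m)" for e m
      by simp
    have "qvar powi (e\<^sup>2) * qbinom s e
          * (qvar powi (m * (m + (R + e - r) - R)) * rr_sum ((R + e - r) + m) (- R) * qbinom r m)
        = (qvar powi ((e + m)\<^sup>2 - r * (e + m)) * rr_sum (R - r + (e + m)) (- R))
          * qvar powi (e * (r - m)) * qbinom s e * qbinom r m" for e m
    proof -
      have "qvar powi (e\<^sup>2) * qbinom s e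
          * (qvar powi (m * (m + (R + e - r) - R)) * rr_sum ((R + e - r) + m) (- R) * qbinom r m)
        = (qvar powi (e\<^sup>2) * qvar powi (m * (m + (R + e - r) - R)))
          * (rr_sum (R - r + (e + m)) (- R) * qbinom s e * qbinom r m)"
        unfolding 2 by (simp only: mult_ac)
      then show ?thesis
        unfolding 1 by (simp only: mult_ac)
    qed
    then show ?thesis
      by (simp only: sum_distrib_left)
  qed
  also have "\<dots> = nested_rr_sum R r s"
    using q_Vandermonde[OF assms(1,2), of "\<lambda>p. qvar powi (p\<^sup>2 - r * p) * rr_sum (R - r + p) (- R)"]
    by (simp add: nested_rr_sum_def add.commute)
  finally show ?thesis .
qed

text \<open>
  The left side for b = 8 in the variables d = n_1, a = n_2, g = n_4 - n_1, i = n_5 - n_2. Trinomial revision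
  turns [d + g, d] [s, d + g] into [s, d] [s - d, g], so that the sums over i, g and over a, d are both
  convolutions. What is left is a sum over p = a + d to which \<open>rr_sum_transform\<close> applies with T = r + s.
\<close>

lemma quadruple_sum_8:
  assumes "0 \<le> s" "0 \<le> r" "r \<le> R"
  shows "(\<Sum>a\<in>{0..r}. \<Sum>d\<in>{0..s}. \<Sum>i\<in>{0..R}. \<Sum>g\<in>{0..s}.
      qvar powi (d\<^sup>2 + a\<^sup>2 + (d + g)\<^sup>2 + (a + i)\<^sup>2 + d * a + a * (d + g) + (d + g) * (a + i) + (a + i) * s
         - d * r - a * r - (d + g) * R - (a + i) * R)
      * (qbinom (d + g) d * qbinom s (d + g) * qbinom r a * qbinom (R - a) i)) = nested_rr_sum R r s"
    (is "?L = _")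
proof -
  have inner: "(\<Sum>i\<in>{0..R}. \<Sum>g\<in>{0..s}.
      qvar powi (d\<^sup>2 + a\<^sup>2 + (d + g)\<^sup>2 + (a + i)\<^sup>2 + d * a + a * (d + g) + (d + g) * (a + i) + (a + i) * s
         - d * r - a * r - (d + g) * R - (a + i) * R)
      * (qbinom (d + g) d * qbinom s (d + g) * qbinom r a * qbinom (R - a) i))
    = (qvar powi (2 * (a + d)\<^sup>2 + ((R - r) + 2 * (- R)) * (a + d))
        * rr_sum ((R - r) + (r + s) - (a + d)) (- R + 2 * (a + d)))
      * qvar powi (a * (s - d)) * qbinom r a * qbinom s d"
    if "d \<in> {0..s}" "a \<in> {0..r}" for d a
  proof -
    have h: "rr_sum ((R - r) + (r + s) - (a + d)) (- R + 2 * (a + d)) = (\<Sum>i\<in>{0..R}. \<Sum>g\<in>{0..s}.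
      qvar powi ((i + g)\<^sup>2 + (- R + 2 * (a + d)) * (i + g) + i * (s - d - g))
        * qbinom (R - a) i * qbinom (s - d) g)"
      using q_Vandermonde_rr_sum[of "R - a" "s - d" R s "- R + 2 * (a + d)"] assms that
      by (simp add: algebra_simps)
    have tri: "qbinom (d + g) d * qbinom s (d + g) * x * y = qbinom s d * qbinom (s - d) g * x * y"
      for g x y
      using qbinom_revision[of s d g] by (simp add: mult_ac)
    have "qvar powi (d\<^sup>2 + a\<^sup>2 + (d + g)\<^sup>2 + (a + i)\<^sup>2 + d * a + a * (d + g) + (d + g) * (a + i) + (a + i) * s
         - d * r - a * r - (d + g) * R - (a + i) * R)
      = qvar powi (2 * (a + d)\<^sup>2 + ((R - r) + 2 * (- R)) * (a + d)) * qvar powi (a * (s - d))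
        * qvar powi ((i + g)\<^sup>2 + (- R + 2 * (a + d)) * (i + g) + i * (s - d - g))" for i g
      unfolding qvar_powi_mult by (simp add: algebra_simps power2_eq_square)
    then show ?thesis
      unfolding h tri sum_distrib_left sum_distrib_right by (intro sum.cong refl) (simp only: mult_ac)
  qed
  have "?L = (\<Sum>p\<in>{0..r + s}. qvar powi (2 * p\<^sup>2 + ((R - r) + 2 * (- R)) * p)
        * rr_sum ((R - r) + (r + s) - p) (- R + 2 * p) * qbinom (r + s) p)"
    by (subst q_Vandermonde[OF assms(2,1), symmetric]) (intro sum.cong refl inner)
  also have "\<dots> = (\<Sum>m\<in>{0..r + s}. qvar powi (m * (m + (R - r) - R)) * rr_sum ((R - r) + m) (- R)
      * qbinom (r + s) m)"
    using assms by (subst rr_sum_transform) auto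
  also have "\<dots> = nested_rr_sum R r s"
    unfolding nested_rr_sum_def by (simp add: algebra_simps power2_eq_square)
  finally show ?thesis .
qed

section \<open>The sums in the theorem\<close>

lemma sum'_eq_sum_reindex:
  assumes "finite B" "inj_on \<phi> B" "\<phi> ` B \<subseteq> I" "\<And>n. n \<in> I \<Longrightarrow> f n \<noteq> 0 \<Longrightarrow> n \<in> \<phi> ` B"
  shows "sum' f I = (\<Sum>x\<in>B. f (\<phi> x))"
proof -
  have sub: "{n \<in> I. f n \<noteq> 0} \<subseteq> \<phi> ` B"
    using assms(4) by auto
  then have "finite {n \<in> I. f n \<noteq> 0}"
    by (rule finite_subset) (use assms(1) in simp)
  then have "sum' f I = sum f {n \<in> I. f n \<noteq> 0}"
    by (simp add: sum.G_def)
  also have "\<dots> = sum f (\<phi> ` B)"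
    by (rule sum.mono_neutral_left) (use sub assms(1,3) in auto)
  also have "\<dots> = (\<Sum>x\<in>B. f (\<phi> x))"
    by (simp add: sum.reindex[OF assms(2)])
  finally show ?thesis .
qed

text \<open>
  The sums on the right, for one and for two summation variables. The constant C collects the squares
  of the prescribed numbers that have no summation variable attached.
\<close>

lemma vector_sum_single:
  assumes "0 \<le> N"
  shows "sum' (\<lambda>m. qvar powi (C + (R\<^sup>2 - R * m 1 + (m 1)\<^sup>2)) * qbinom N (m 1)) (int_vectors {1})
    = qvar powi (C + R\<^sup>2) * rr_sum N (- R)"
proof -
  have "sum' (\<lambda>m. qvar powi (C + (R\<^sup>2 - R * m 1 + (m 1)\<^sup>2)) * qbinom N (m 1)) (int_vectors {1})
    = (\<Sum>x\<in>{0..N}. qvar powi (C + (R\<^sup>2 - R * x + x\<^sup>2)) * qbinom N x)"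
  proof (subst sum'_eq_sum_reindex[where B = "{0..N}" and \<phi> = "\<lambda>x. (\<lambda>_. 0)(1 := x)"])
    show "inj_on (\<lambda>x. (\<lambda>_. 0)(1 := x)) {0..N}"
      by (rule inj_on_inverseI[where g = "\<lambda>n. n 1"]) simp
    show "m \<in> (\<lambda>x. (\<lambda>_. 0)(1 := x)) ` {0..N}"
      if "m \<in> int_vectors {1}" "qvar powi (C + (R\<^sup>2 - R * m 1 + (m 1)\<^sup>2)) * qbinom N (m 1) \<noteq> 0" for m
      using that by (intro image_eqI[where x = "m 1"] ext) (auto simp: int_vectors_def qbinom_nonzero_iff)
  qed (auto simp: int_vectors_def)
  also have "\<dots> = qvar powi (C + R\<^sup>2) * rr_sum N (- R)"
  proof -
    have "qvar powi (C + (R\<^sup>2 - R * x + x\<^sup>2)) = qvar powi (C + R\<^sup>2) * qvar powi (x\<^sup>2 + - R * x)" for x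
      unfolding qvar_powi_mult by (simp add: algebra_simps)
    then show ?thesis
      unfolding rr_sum_def sum_distrib_left by (intro sum.cong refl) (simp only: mult_ac)
  qed
  finally show ?thesis .
qed

lemma vector_sum_double:
  assumes "0 \<le> r" "0 \<le> s" "r \<le> R"
  shows "sum' (\<lambda>m. qvar powi (C + (R\<^sup>2 - R * m 1 + (m 1)\<^sup>2 + (r\<^sup>2 - r * m 2 + (m 2)\<^sup>2)))
      * qbinom (r + s) (m 2) * qbinom (R - r + m 2) (m 1)) (int_vectors {1, 2})
    = qvar powi (C + R\<^sup>2 + r\<^sup>2) * nested_rr_sum R r s" (is "sum' ?f _ = _")
proof -
  have "sum' ?f (int_vectors {1, 2})
    = (\<Sum>(p, x)\<in>{0..r + s} \<times> {0..R + s}. ?f ((\<lambda>_. 0)(1 := x, 2 := p)))"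
    unfolding case_prod_unfold
  proof (rule sum'_eq_sum_reindex)
    show "inj_on (\<lambda>y. (\<lambda>_::int. 0)(1 := snd y, 2 := fst y)) ({0..r + s} \<times> {0..R + s})"
      by (rule inj_on_inverseI[where g = "\<lambda>n. (n 2, n 1)"]) auto
    show "m \<in> (\<lambda>y. (\<lambda>_::int. 0)(1 := snd y, 2 := fst y)) ` ({0..r + s} \<times> {0..R + s})"
      if "m \<in> int_vectors {1, 2}" "?f m \<noteq> 0" for m
      using that by (intro image_eqI[where x = "(m 2, m 1)"] ext)
         (auto simp: int_vectors_def qbinom_nonzero_iff)
  qed (auto simp: int_vectors_def)
  also have "\<dots> = (\<Sum>p\<in>{0..r + s}. \<Sum>x\<in>{0..R + s}.
      (qvar powi (C + R\<^sup>2 + r\<^sup>2) * qvar powi (p\<^sup>2 - r * p) * qbinom (r + s) p * qvar powi (x\<^sup>2 + - R * x)) * qbinom (R - r + p) x)"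
  proof -
    have "qvar powi (C + (R\<^sup>2 - R * x + x\<^sup>2 + (r\<^sup>2 - r * p + p\<^sup>2)))
      = qvar powi (C + R\<^sup>2 + r\<^sup>2) * qvar powi (p\<^sup>2 - r * p) * qvar powi (x\<^sup>2 + - R * x)" for x p
      unfolding qvar_powi_mult by (simp add: algebra_simps)
    then show ?thesis
      unfolding sum.cartesian_product by (intro sum.cong refl) (simp add: case_prod_unfold mult_ac)
  qed
  also have "\<dots> = (\<Sum>p\<in>{0..r + s}. \<Sum>x\<in>{0..R - r + p}.
      (qvar powi (C + R\<^sup>2 + r\<^sup>2) * qvar powi (p\<^sup>2 - r * p) * qbinom (r + s) p * qvar powi (x\<^sup>2 + - R * x)) * qbinom (R - r + p) x)"
    by (intro sum.cong refl sum_qbinom_extend) auto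
  also have "\<dots> = qvar powi (C + R\<^sup>2 + r\<^sup>2) * nested_rr_sum R r s"
    unfolding nested_rr_sum_def rr_sum_def sum_distrib_left sum_distrib_right
    by (intro sum.cong refl) (simp add: mult_ac)
  finally show ?thesis .
qed

text \<open>
  The sums on the left. Fixing the prescribed entries, the index set is parametrised by the free
  entries (for b = 7 and b = 8 by increments of entries), and the form Q3 splits into the squares of
  the prescribed entries and the exponent required by the convolution or by the fourfold sum.
\<close>

lemma gap_sum_4:
  fixes r :: "int \<Rightarrow> int"
  assumes "0 \<le> r 1"
  shows "sum' (\<lambda>n. qvar powi (Q3 4 n) * qbinom (n 5) (n 2) * qbinom (r 1 - n (- 2)) (n 1 - n (- 2)))
      {n \<in> int_vectors {1, 2, 5}. n 5 = r 1} = qvar powi ((r 1)\<^sup>2) * rr_sum (2 * r 1) (- r 1)"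
    (is "sum' ?f ?I = _")
proof -
  define \<phi> :: "int \<times> int \<Rightarrow> int \<Rightarrow> int" where
    "\<phi> = (\<lambda>(x, y). (\<lambda>_. 0)(1 := y, 2 := x, 5 := r 1))"
  have "sum' ?f ?I = (\<Sum>z\<in>{0..r 1} \<times> {0..r 1}. ?f (\<phi> z))"
  proof (rule sum'_eq_sum_reindex)
    show "inj_on \<phi> ({0..r 1} \<times> {0..r 1})"
      by (rule inj_on_inverseI[where g = "\<lambda>n. (n 2, n 1)"]) (auto simp: \<phi>_def)
    show "n \<in> \<phi> ` ({0..r 1} \<times> {0..r 1})" if "n \<in> ?I" "?f n \<noteq> 0" for n
      using that by (intro image_eqI[where x = "(n 2, n 1)"] ext)
        (auto simp: \<phi>_def int_vectors_def qbinom_nonzero_iff)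
  qed (auto simp: \<phi>_def int_vectors_def)
  also have "\<dots> = qvar powi ((r 1)\<^sup>2) * (\<Sum>x\<in>{0..r 1}. \<Sum>y\<in>{0..r 1}.
      qvar powi ((x + y)\<^sup>2 + - r 1 * (x + y) + x * (r 1 - y)) * qbinom (r 1) x * qbinom (r 1) y)"
  proof -
    have "Q3 4 (\<phi> (x, y)) = (r 1)\<^sup>2 + ((x + y)\<^sup>2 + - r 1 * (x + y) + x * (r 1 - y))" for x y
      unfolding Q3_4 \<phi>_def by (simp add: algebra_simps power2_eq_square)
    then have "qvar powi (Q3 4 (\<phi> (x, y))) = qvar powi ((r 1)\<^sup>2)
        * qvar powi ((x + y)\<^sup>2 + - r 1 * (x + y) + x * (r 1 - y))" for x y
      by (simp only: qvar_powi_mult)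
    moreover have "\<phi> (x, y) (- 2) = 0" "\<phi> (x, y) 1 = y" "\<phi> (x, y) 2 = x"
        "\<phi> (x, y) 5 = r 1" for x y
      by (simp_all add: \<phi>_def)
    ultimately show ?thesis
      unfolding sum.cartesian_product' sum_distrib_left
      by (intro sum.cong refl) (simp only: diff_zero mult_ac)
  qed
  also have "\<dots> = qvar powi ((r 1)\<^sup>2) * rr_sum (2 * r 1) (- r 1)"
    using q_Vandermonde_rr_sum[OF assms assms order.refl order.refl] by (simp only: mult_2)
  finally show ?thesis .
qed

lemma gap_sum_5:
  fixes r :: "int \<Rightarrow> int"
  assumes "0 \<le> r 2" "r 2 \<le> r 1"
  shows "sum' (\<lambda>n. qvar powi (Q3 5 n) * qbinom (n 4) (n 1) * qbinom (r 1 - n (- 1)) (n 2 - n (- 1)))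
      {n \<in> int_vectors {1, 2, 4, 7}. n 7 = r 1 \<and> n 4 = r 2}
    = qvar powi ((r 2)\<^sup>2 + (r 1)\<^sup>2) * rr_sum (r 1 + r 2) (- r 1)"
    (is "sum' ?f ?I = _")
proof -
  define \<phi> :: "int \<times> int \<Rightarrow> int \<Rightarrow> int" where
    "\<phi> = (\<lambda>(x, y). (\<lambda>_. 0)(1 := y, 2 := x, 4 := r 2, 7 := r 1))"
  have "sum' ?f ?I = (\<Sum>z\<in>{0..r 1} \<times> {0..r 2}. ?f (\<phi> z))"
  proof (rule sum'_eq_sum_reindex)
    show "inj_on \<phi> ({0..r 1} \<times> {0..r 2})"
      by (rule inj_on_inverseI[where g = "\<lambda>n. (n 2, n 1)"]) (auto simp: \<phi>_def)
    show "n \<in> \<phi> ` ({0..r 1} \<times> {0..r 2})" if "n \<in> ?I" "?f n \<noteq> 0" for n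
      using that by (intro image_eqI[where x = "(n 2, n 1)"] ext)
        (auto simp: \<phi>_def int_vectors_def qbinom_nonzero_iff)
  qed (auto simp: \<phi>_def int_vectors_def)
  also have "\<dots> = qvar powi ((r 2)\<^sup>2 + (r 1)\<^sup>2) * (\<Sum>x\<in>{0..r 1}. \<Sum>y\<in>{0..r 2}.
      qvar powi ((x + y)\<^sup>2 + - r 1 * (x + y) + x * (r 2 - y)) * qbinom (r 1) x * qbinom (r 2) y)"
  proof -
    have "Q3 5 (\<phi> (x, y)) = ((r 2)\<^sup>2 + (r 1)\<^sup>2) + ((x + y)\<^sup>2 + - r 1 * (x + y) + x * (r 2 - y))" for x y
      unfolding Q3_5 \<phi>_def by (simp add: algebra_simps power2_eq_square)
    then have "qvar powi (Q3 5 (\<phi> (x, y))) = qvar powi ((r 2)\<^sup>2 + (r 1)\<^sup>2)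
        * qvar powi ((x + y)\<^sup>2 + - r 1 * (x + y) + x * (r 2 - y))" for x y
      by (simp only: qvar_powi_mult)
    moreover have "\<phi> (x, y) (- 1) = 0" "\<phi> (x, y) 1 = y" "\<phi> (x, y) 2 = x"
        "\<phi> (x, y) 4 = r 2" "\<phi> (x, y) 7 = r 1" for x y
      by (simp_all add: \<phi>_def)
    ultimately show ?thesis
      unfolding sum.cartesian_product' sum_distrib_left
      by (intro sum.cong refl) (simp only: diff_zero mult_ac)
  qed
  also have "\<dots> = qvar powi ((r 2)\<^sup>2 + (r 1)\<^sup>2) * rr_sum (r 1 + r 2) (- r 1)"
    using q_Vandermonde_rr_sum[of "r 1" "r 2" "r 1" "r 2" "- r 1"] assms by simp
  finally show ?thesis .
qed

lemma gap_sum_7: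
  fixes r :: "int \<Rightarrow> int"
  assumes "0 \<le> r 2" "r 2 \<le> r 1"
  shows "sum' (\<lambda>n. qvar powi (Q3 7 n) * (qbinom (n 5) (n 2) * qbinom (n 8) (n 5))
        * (qbinom (r 2 - n (- 2)) (n 1 - n (- 2)) * qbinom (r 1 - n 1) (n 4 - n 1)))
      {n \<in> int_vectors {1, 2, 4, 5, 8, 11}. n 11 = r 1 \<and> n 8 = r 2}
    = qvar powi ((r 1)\<^sup>2 + (r 2)\<^sup>2) * nested_rr_sum (r 1) (r 2) (r 2)"
    (is "sum' ?f ?I = _")
proof -
  define \<phi> :: "int \<times> int \<times> int \<times> int \<Rightarrow> int \<Rightarrow> int" where
    "\<phi> = (\<lambda>(e, a, i, d). (\<lambda>_. 0)(1 := a, 2 := d, 4 := a + i, 5 := e, 8 := r 2, 11 := r 1))"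
  let ?B = "{0..r 2} \<times> {0..r 2} \<times> {0..r 1} \<times> {0..r 2}"
  have "sum' ?f ?I = (\<Sum>z\<in>?B. ?f (\<phi> z))"
  proof (rule sum'_eq_sum_reindex)
    show "inj_on \<phi> ?B"
      by (rule inj_on_inverseI[where g = "\<lambda>n. (n 5, n 1, n 4 - n 1, n 2)"]) (auto simp: \<phi>_def)
    show "n \<in> \<phi> ` ?B" if "n \<in> ?I" "?f n \<noteq> 0" for n
      using that by (intro image_eqI[where x = "(n 5, n 1, n 4 - n 1, n 2)"] ext)
        (auto simp: \<phi>_def int_vectors_def qbinom_nonzero_iff)
  qed (auto simp: \<phi>_def int_vectors_def)
  also have "\<dots> = qvar powi ((r 1)\<^sup>2 + (r 2)\<^sup>2) * nested_rr_sum (r 1) (r 2) (r 2)"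
  proof -
    have "Q3 7 (\<phi> (e, a, i, d)) = ((r 1)\<^sup>2 + (r 2)\<^sup>2)
        + (a\<^sup>2 + d\<^sup>2 + (a + i)\<^sup>2 + e\<^sup>2 + a * d + d * (a + i) + (a + i) * e
         - a * r 2 - d * r 1 - (a + i) * r 1)" for e a i d
      unfolding Q3_7 by (simp add: \<phi>_def)
    then have "qvar powi (Q3 7 (\<phi> (e, a, i, d))) = qvar powi ((r 1)\<^sup>2 + (r 2)\<^sup>2)
        * qvar powi (a\<^sup>2 + d\<^sup>2 + (a + i)\<^sup>2 + e\<^sup>2 + a * d + d * (a + i) + (a + i) * e
         - a * r 2 - d * r 1 - (a + i) * r 1)" for e a i d
      by (simp only: qvar_powi_mult)
    moreover have "\<phi> (e, a, i, d) (- 2) = 0" "\<phi> (e, a, i, d) 1 = a"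
        "\<phi> (e, a, i, d) 2 = d" "\<phi> (e, a, i, d) 4 = a + i" "\<phi> (e, a, i, d) 5 = e"
        "\<phi> (e, a, i, d) 8 = r 2" "\<phi> (e, a, i, d) 11 = r 1" for e a i d
      by (simp_all add: \<phi>_def)
    ultimately show ?thesis
      unfolding sum.cartesian_product' quadruple_sum_7[OF assms(1) assms, symmetric] sum_distrib_left
      by (intro sum.cong refl) (simp only: diff_zero add_diff_cancel_left' mult_ac)
  qed
  finally show ?thesis .
qed

lemma gap_sum_8:
  fixes r :: "int \<Rightarrow> int"
  assumes "0 \<le> r 3" "r 3 \<le> r 2" "r 2 \<le> r 1"
  shows "sum' (\<lambda>n. qvar powi (Q3 8 n) * (qbinom (n 4) (n 1) * qbinom (n 7) (n 4))
        * (qbinom (r 2 - n (- 1)) (n 2 - n (- 1)) * qbinom (r 1 - n 2) (n 5 - n 2)))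
      {n \<in> int_vectors {1, 2, 4, 5, 7, 10, 13}. n 13 = r 1 \<and> n 10 = r 2 \<and> n 7 = r 3}
    = qvar powi ((r 3)\<^sup>2 + (r 1)\<^sup>2 + (r 2)\<^sup>2) * nested_rr_sum (r 1) (r 2) (r 3)"
    (is "sum' ?f ?I = _")
proof -
  define \<phi> :: "int \<times> int \<times> int \<times> int \<Rightarrow> int \<Rightarrow> int" where
    "\<phi> = (\<lambda>(a, d, i, g). (\<lambda>_. 0)(1 := d, 2 := a, 4 := d + g, 5 := a + i,
       7 := r 3, 10 := r 2, 13 := r 1))"
  let ?B = "{0..r 2} \<times> {0..r 3} \<times> {0..r 1} \<times> {0..r 3}"
  have "sum' ?f ?I = (\<Sum>z\<in>?B. ?f (\<phi> z))"
  proof (rule sum'_eq_sum_reindex)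
    show "inj_on \<phi> ?B"
      by (rule inj_on_inverseI[where g = "\<lambda>n. (n 2, n 1, n 5 - n 2, n 4 - n 1)"]) (auto simp: \<phi>_def)
    show "n \<in> \<phi> ` ?B" if "n \<in> ?I" "?f n \<noteq> 0" for n
      using that by (intro image_eqI[where x = "(n 2, n 1, n 5 - n 2, n 4 - n 1)"] ext)
        (auto simp: \<phi>_def int_vectors_def qbinom_nonzero_iff)
  qed (auto simp: \<phi>_def int_vectors_def)
  also have "\<dots> = qvar powi ((r 3)\<^sup>2 + (r 1)\<^sup>2 + (r 2)\<^sup>2) * nested_rr_sum (r 1) (r 2) (r 3)"
  proof -
    have "Q3 8 (\<phi> (a, d, i, g)) = ((r 3)\<^sup>2 + (r 1)\<^sup>2 + (r 2)\<^sup>2)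
        + (d\<^sup>2 + a\<^sup>2 + (d + g)\<^sup>2 + (a + i)\<^sup>2 + d * a + a * (d + g) + (d + g) * (a + i) + (a + i) * r 3
         - d * r 2 - a * r 2 - (d + g) * r 1 - (a + i) * r 1)" for a d i g
      unfolding Q3_8 by (simp add: \<phi>_def)
    then have "qvar powi (Q3 8 (\<phi> (a, d, i, g))) = qvar powi ((r 3)\<^sup>2 + (r 1)\<^sup>2 + (r 2)\<^sup>2)
        * qvar powi (d\<^sup>2 + a\<^sup>2 + (d + g)\<^sup>2 + (a + i)\<^sup>2 + d * a + a * (d + g) + (d + g) * (a + i) + (a + i) * r 3
         - d * r 2 - a * r 2 - (d + g) * r 1 - (a + i) * r 1)" for a d i g
      by (simp only: qvar_powi_mult)
    moreover have "\<phi> (a, d, i, g) (- 1) = 0" "\<phi> (a, d, i, g) 1 = d"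
        "\<phi> (a, d, i, g) 2 = a" "\<phi> (a, d, i, g) 4 = d + g"
        "\<phi> (a, d, i, g) 5 = a + i" "\<phi> (a, d, i, g) 7 = r 3"
        "\<phi> (a, d, i, g) 10 = r 2" "\<phi> (a, d, i, g) 13 = r 1" for a d i g
      by (simp_all add: \<phi>_def)
    ultimately show ?thesis
      unfolding sum.cartesian_product' quadruple_sum_8[OF assms(1) order.trans[OF assms(1,2)] assms(3), symmetric] sum_distrib_left
      by (intro sum.cong refl) (simp only: diff_zero add_diff_cancel_left' mult_ac)
  qed
  finally show ?thesis .
qed

theorem theorem6:
  fixes b f k :: int and r :: "int \<Rightarrow> int"
  assumes "b \<in> {4, 5, 7, 8}"
    and "f = 2 * b - 3"
    and "k = round (real_of_int b / 3)"
    and "\<forall>i\<in>{1..<k}. r i \<ge> r (i + 1)"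
    and "r k \<ge> 0"
  shows "(b = 3 * k + 1 \<longrightarrow>
      sum' (\<lambda>n. qvar powi (Q3 b n)
          * (\<Prod>j\<in>{1..k}. qbinom (n (3 * j + 2)) (n (3 * j - 1)))
          * (\<Prod>j\<in>{1..k}. qbinom (r (k - j + 1) - n (3 * j - 5)) (n (3 * j - 2) - n (3 * j - 5))))
        {n \<in> int_vectors (gaps3 b). \<forall>j\<in>{1..k}. n (f + 3 - 3 * j) = r j}
      = sum' (\<lambda>m. qvar powi (\<Sum>i\<in>{1..k}. (r i)\<^sup>2 - r i * m i + (m i)\<^sup>2)
          * qbinom (2 * r k) (m k)
          * (\<Prod>i\<in>{1..k - 1}. qbinom (r i - r (i + 1) + m (i + 1)) (m i)))
        (int_vectors {1..k}))
    \<and> (b = 3 * k - 1 \<longrightarrow>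
      sum' (\<lambda>n. qvar powi (Q3 b n)
          * (\<Prod>j\<in>{1..k - 1}. qbinom (n (3 * j + 1)) (n (3 * j - 2)))
          * (\<Prod>j\<in>{1..k - 1}. qbinom (r (k - j) - n (3 * j - 4)) (n (3 * j - 1) - n (3 * j - 4))))
        {n \<in> int_vectors (gaps3 b). \<forall>j\<in>{1..k}. n (f + 3 - 3 * j) = r j}
      = sum' (\<lambda>m. qvar powi ((r k)\<^sup>2 + (\<Sum>i\<in>{1..k - 1}. (r i)\<^sup>2 - r i * m i + (m i)\<^sup>2))
          * qbinom (r (k - 1) + r k) (m (k - 1))
          * (\<Prod>i\<in>{1..k - 2}. qbinom (r i - r (i + 1) + m (i + 1)) (m i)))
        (int_vectors {1..k - 1}))"
proof -
  have I: "{1..2::int} = {1, 2}" "{1..3::int} = {1, 2, 3}" "{1..<2::int} = {1}" "{1..<3::int} = {1, 2}"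
    by auto
  consider "b = 4" "k = 1" | "b = 5" "k = 2" | "b = 7" "k = 2" | "b = 8" "k = 3"
    using assms(1,3) by (auto simp: round_def)
  then show ?thesis
  proof cases
    case 1
    then show ?thesis
      using assms(2,5) gap_sum_4[of r] vector_sum_single[of "2 * r 1" 0 "r 1"] by (simp add: gaps3_values)
  next
    case 2
    have r: "0 \<le> r 2" "r 2 \<le> r 1"
      using assms(4,5) unfolding 2 I by auto
    have f: "f = 7"
      using assms(2) 2 by simp
    show ?thesis
      using gap_sum_5[OF r] vector_sum_single[of "r 1 + r 2" "(r 2)\<^sup>2" "r 1"] r
      unfolding 2 I f gaps3_values by simp
  next
    case 3
    have r: "0 \<le> r 2" "r 2 \<le> r 1"
      using assms(4,5) unfolding 3 I by auto
    have f: "f = 11"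
      using assms(2) 3 by simp
    show ?thesis
      using gap_sum_7[OF r] vector_sum_double[of "r 2" "r 2" "r 1" 0] r
      unfolding 3 I f gaps3_values by simp
  next
    case 4
    have r: "0 \<le> r 3" "r 3 \<le> r 2" "r 2 \<le> r 1"
      using assms(4,5) unfolding 4 I by auto
    have f: "f = 13"
      using assms(2) 4 by simp
    show ?thesis
      using gap_sum_8[OF r] vector_sum_double[of "r 2" "r 3" "r 1" "(r 3)\<^sup>2"] r
      unfolding 4 I f gaps3_values by (simp add: I)
  qed
qed

end
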